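(* Let $D$ be a real composition division algebra of dimension $d\in\{2,4,8\}$, let $E_D\to\mathbb{RP}^d$ be its coordinate-deletion bundle (defined in the context), and put $$X=\mathbb{RP}^d\setminus\{P_0,\dots,P_d\},$$ where $P_0,\dots,P_d$ are the coordinate points. Then $E_D|_X$ is trivial. More precisely, if a vector in the fibre is represented on $U_i\cap X$ by $w_i\in\mathbb R^d$, then $$\tau_i(w_i)=M_i^{-1}w_i$$ defines a global trivialization $\tau:E_D|_X\xrightarrow{\ \cong\ }X\times\mathbb R^d$.
   Context: $D$ is a finite-dimensional unital (not necessarily associative) real composition division algebra with multiplicative quadratic norm $N:D\to\mathbb R$, $N(uv)=N(u)N(v)$, $N(1)=1$, whose polar form $\langle u,v\rangle=\frac12(N(u+v)-N(u)-N(v))$ is positive definite, and $d=\dim_{\mathbb R}D\in\{2,4,8\}$; thus $D\cong\mathbb C,\mathbb H$ or $\mathbb O$. Fix an ordered orthonormal basis $(e_0,\dots,e_{d-1})$ of $D$. For $u\in D$, $L_u(v)=uv$ and $M(u)\in M_d(\mathbb R)$ is the matrix of $L_u$ in this basis. On $\mathbb{RP}^d=\{[\alpha_0:\cdots:\alpha_d]\}$ let $U_i=\{\alpha_i\neq0\}$, let $P_i=[0:\cdots:0:1:0:\cdots:0]$ ($1$ in position $i$, $i=0,\dots,d$) be the coordinate points, let $\sigma_i:\{0,\dots,d-1\}\to\{0,\dots,d\}\setminus\{i\}$ be the increasing bijection, define $q_i:U_i\to D$ by $q_i([\alpha])=\sum_{r=0}^{d-1}\frac{\alpha_{\sigma_i(r)}}{\alpha_i}e_r$,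 and put $M_i(p)=M(q_i(p))$; $M_i(p)$ is invertible for $p\in U_i\setminus\{P_i\}$. The bundle $E_D\to\mathbb{RP}^d$ is the rank-$d$ real vector bundle obtained by gluing the $U_i\times\mathbb R^d$ via the transition functions $g_{ij}=M_iM_j^{-1}:U_i\cap U_j\to\mathrm{GL}_d(\mathbb R)$ for $i\ne j$ (and $g_{ii}=I_d$), with the convention that local representatives of a vector satisfy $w_i=g_{ij}w_j$. *)

theory Defs
  imports "HOL-Analysis.Analysis"
begin

section \<open>Real composition division algebras\<close>

text \<open>The multiplication is a plain binary operation on a real vector space, since the type classes
  of HOL for algebras all require associativity.\<close>

definition polar_form :: "('a::real_vector \<Rightarrow> real) \<Rightarrow> 'a \<Rightarrow> 'a \<Rightarrow> real"
  where "polar_form N u v = (N (u + v) - N u - N v) / 2"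

locale composition_division_algebra =
  fixes mul :: "'a::real_vector \<Rightarrow> 'a \<Rightarrow> 'a"
    and one :: 'a
    and N :: "'a \<Rightarrow> real"
  assumes finite_dimensional: "\<exists>B::'a set. finite B \<and> span B = UNIV"
    and mult_bilinear: "bilinear mul"
    and mult_one_left: "mul one u = u"
    and mult_one_right: "mul u one = u"
    and division_left: "u \<noteq> 0 \<Longrightarrow> bij (\<lambda>v. mul u v)"
    and division_right: "u \<noteq> 0 \<Longrightarrow> bij (\<lambda>v. mul v u)"
    and norm_scale: "N (c *\<^sub>R u) = c\<^sup>2 * N u"
    and polar_bilinear: "bilinear (polar_form N)"
    and norm_mult: "N (mul u v) = N u * N v"
    and norm_one: "N one = 1"
    and polar_positive_definite: "u \<noteq> 0 \<Longrightarrow> polar_form N u u > 0"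

text \<open>Bases are indexed by a finite linearly ordered type \<open>'n\<close>, which plays the role of
  the ordered index set \<open>{0,...,d-1}\<close> with \<open>d = CARD('n)\<close>.\<close>

definition orthonormal_basis :: "('a::real_vector \<Rightarrow> real) \<Rightarrow> ('n \<Rightarrow> 'a) \<Rightarrow> bool"
  where "orthonormal_basis N e \<longleftrightarrow>
    (\<forall>r s. polar_form N (e r) (e s) = (if r = s then 1 else 0)) \<and> span (range e) = UNIV"

definition left_mult_matrix ::
    "('a::real_vector \<Rightarrow> 'a \<Rightarrow> 'a) \<Rightarrow> ('n::finite \<Rightarrow> 'a) \<Rightarrow> 'a \<Rightarrow> real^'n^'n"
  where "left_mult_matrix mul e u = (\<chi> r c. representation (range e) (mul u (e c)) (e r))"


section \<open>Quotient topologies and real projective space\<close>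

definition quotient_topology :: "'a topology \<Rightarrow> ('a \<Rightarrow> 'b) \<Rightarrow> 'b topology"
  where "quotient_topology X q =
    topology (\<lambda>V. V \<subseteq> q ` topspace X \<and> openin X {x \<in> topspace X. q x \<in> V})"

lemma openin_quotient_topology:
  "openin (quotient_topology X q) V \<longleftrightarrow>
     V \<subseteq> q ` topspace X \<and> openin X {x \<in> topspace X. q x \<in> V}"
proof -
  have "istopology (\<lambda>V. V \<subseteq> q ` topspace X \<and> openin X {x \<in> topspace X. q x \<in> V})"
    (is "istopology ?P")
    unfolding istopology_def
  proof (rule conjI; intro allI impI)
    fix S T
    assume S: "?P S" and T: "?P T"
    have "{x \<in> topspace X. q x \<in> S \<inter> T}
        = {x \<in> topspace X. q x \<in> S} \<inter> {x \<in> topspace X. q x \<in> T}" by blast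
    then have "openin X {x \<in> topspace X. q x \<in> S \<inter> T}"
      using openin_Int[OF conjunct2[OF S] conjunct2[OF T]] by simp
    then show "?P (S \<inter> T)" using S by blast
  next
    fix K
    assume K: "\<forall>V\<in>K. ?P V"
    have "{x \<in> topspace X. q x \<in> \<Union>K} = \<Union>((\<lambda>V. {x \<in> topspace X. q x \<in> V}) ` K)" by blast
    moreover have "openin X (\<Union>((\<lambda>V. {x \<in> topspace X. q x \<in> V}) ` K))"
      using K by (intro openin_Union) blast
    ultimately show "?P (\<Union>K)" using K by (simp add: Sup_le_iff)
  qed
  then show ?thesis
    unfolding quotient_topology_def by (rule arg_cong[where f = "\<lambda>P. P V", OF topology_inverse'])
qed

lemma topspace_quotient_topology: "topspace (quotient_topology X q) = q ` topspace X"
proof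
  show "topspace (quotient_topology X q) \<subseteq> q ` topspace X"
    using openin_topspace[of "quotient_topology X q"]
    unfolding openin_quotient_topology by (rule conjunct1)
  have "{x \<in> topspace X. q x \<in> q ` topspace X} = topspace X" by auto
  then have "openin (quotient_topology X q) (q ` topspace X)"
    unfolding openin_quotient_topology by simp
  then show "q ` topspace X \<subseteq> topspace (quotient_topology X q)"
    by (rule openin_subset)
qed

lemma quotient_map_quotient_topology: "quotient_map X (quotient_topology X q) q"
  by (simp add: quotient_map_def openin_quotient_topology topspace_quotient_topology)

text \<open>Points of projective space are the lines through the origin. The homogeneous coordinates are
  indexed by a finite linearly ordered type \<open>'m\<close> in the role of \<open>{0,...,d}\<close>.\<close>

type_synonym 'm line = "(real, 'm) vec set"

definition proj_point :: "real^'m \<Rightarrow> 'm line"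
  where "proj_point \<alpha> = span {\<alpha>}"

definition real_projective_space :: "'m::finite line topology"
  where "real_projective_space = quotient_topology (top_of_set (UNIV - {0})) proj_point"

definition affine_chart :: "'m::finite \<Rightarrow> 'm line set"
  where "affine_chart i = {proj_point \<alpha> | \<alpha>. \<alpha> $ i \<noteq> 0}"

definition coordinate_point :: "'m::finite \<Rightarrow> 'm line"
  where "coordinate_point i = proj_point (axis i 1)"


section \<open>Real vector bundles given by gluing data\<close>

text \<open>\<open>fibre_add\<close> is only meaningful for two elements of the same fibre.\<close>

record ('e, 'p) vbundle =
  total_space :: "'e topology"
  base_space :: "'p topology"
  bundle_proj :: "'e \<Rightarrow> 'p"
  fibre_add :: "'e \<Rightarrow> 'e \<Rightarrow> 'e"
  fibre_scale :: "real \<Rightarrow> 'e \<Rightarrow> 'e"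

definition bundle_restrict :: "('e, 'p) vbundle \<Rightarrow> 'p set \<Rightarrow> ('e, 'p) vbundle"
  where "bundle_restrict E X = E\<lparr>
    total_space := subtopology (total_space E) {x. bundle_proj E x \<in> X},
    base_space := subtopology (base_space E) X\<rparr>"

definition product_bundle :: "'p topology \<Rightarrow> ('p \<times> (real^'n), 'p) vbundle"
  where "product_bundle B = \<lparr>
    total_space = prod_topology B euclidean,
    base_space = B,
    bundle_proj = fst,
    fibre_add = (\<lambda>(p, v) (p', w). (p, v + w)),
    fibre_scale = (\<lambda>c (p, v). (p, c *\<^sub>R v))\<rparr>"

definition bundle_iso :: "('e, 'p) vbundle \<Rightarrow> ('f, 'p) vbundle \<Rightarrow> ('e \<Rightarrow> 'f) \<Rightarrow> bool"
  where "bundle_iso E F \<tau> \<longleftrightarrow>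
    base_space E = base_space F \<and>
    homeomorphic_map (total_space E) (total_space F) \<tau> \<and>
    (\<forall>x \<in> topspace (total_space E). bundle_proj F (\<tau> x) = bundle_proj E x) \<and>
    (\<forall>x \<in> topspace (total_space E). \<forall>y \<in> topspace (total_space E).
       bundle_proj E x = bundle_proj E y \<longrightarrow> \<tau> (fibre_add E x y) = fibre_add F (\<tau> x) (\<tau> y)) \<and>
    (\<forall>x \<in> topspace (total_space E). \<forall>c. \<tau> (fibre_scale E c x) = fibre_scale F c (\<tau> x))"

abbreviation trivialization ::
    "('e, 'p) vbundle \<Rightarrow> ('e \<Rightarrow> 'p \<times> (real^'n)) \<Rightarrow> bool"
  where "trivialization E \<tau> \<equiv> bundle_iso E (product_bundle (base_space E)) \<tau>"

text \<open>Gluing the \<open>U i \<times> \<real>\<^sup>n\<close> with the convention \<open>w\<^sub>i = g\<^sub>i\<^sub>j w\<^sub>j\<close> on \<open>U i \<inter> U j\<close>. When \<open>g\<close> is a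
  cocycle, \<open>glue_rel\<close> is an equivalence relation on the disjoint union and \<open>glue_class U g i p w\<close> is
  the point of the bundle over \<open>p\<close> whose representative over \<open>U i\<close> is \<open>w\<close>.\<close>

definition glue_rel ::
    "('i \<Rightarrow> 'p set) \<Rightarrow> ('i \<Rightarrow> 'i \<Rightarrow> 'p \<Rightarrow> real^'n^'n)
      \<Rightarrow> (('i \<times> 'p \<times> (real^'n)) \<times> ('i \<times> 'p \<times> (real^'n))) set"
  where "glue_rel U g =
    {((i, p, v), (j, p', w)). p = p' \<and> p \<in> U i \<inter> U j \<and> v = g i j p *v w}"

definition glue_class ::
    "('i \<Rightarrow> 'p set) \<Rightarrow> ('i \<Rightarrow> 'i \<Rightarrow> 'p \<Rightarrow> real^'n^'n)
      \<Rightarrow> 'i \<Rightarrow> 'p \<Rightarrow> real^'n \<Rightarrow> ('i \<times> 'p \<times> (real^'n)) set"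
  where "glue_class U g i p w = glue_rel U g `` {(i, p, w)}"

definition glued_bundle ::
    "'p topology \<Rightarrow> ('i \<Rightarrow> 'p set) \<Rightarrow> ('i \<Rightarrow> 'i \<Rightarrow> 'p \<Rightarrow> real^'n^'n)
      \<Rightarrow> (('i \<times> 'p \<times> (real^'n)) set, 'p) vbundle"
  where "glued_bundle B U g = \<lparr>
    total_space = quotient_topology
      (sum_topology (\<lambda>i. prod_topology (subtopology B (U i)) euclidean) UNIV)
      (\<lambda>(i, p, w). glue_class U g i p w),
    base_space = B,
    bundle_proj = (\<lambda>x. THE p. \<exists>i w. p \<in> U i \<and> x = glue_class U g i p w),
    fibre_add = (\<lambda>x y. THE z. \<exists>i p v w. p \<in> U i \<and> x = glue_class U g i p v \<and>
      y = glue_class U g i p w \<and> z = glue_class U g i p (v + w)),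
    fibre_scale = (\<lambda>c x. THE z. \<exists>i p w. p \<in> U i \<and> x = glue_class U g i p w \<and>
      z = glue_class U g i p (c *\<^sub>R w))\<rparr>"


section \<open>The coordinate-deletion bundle\<close>

text \<open>The increasing bijection \<open>\<sigma>\<^sub>i\<close> exists and is unique when \<open>CARD('m) = CARD('n) + 1\<close>.\<close>

definition deletion_map :: "'m::{finite,linorder} \<Rightarrow> 'n::{finite,linorder} \<Rightarrow> 'm"
  where "deletion_map i = (THE \<sigma>. strict_mono \<sigma> \<and> bij_betw \<sigma> UNIV (UNIV - {i}))"

definition chart_coord ::
    "('n::{finite,linorder} \<Rightarrow> 'a::real_vector) \<Rightarrow> 'm::{finite,linorder} \<Rightarrow> 'm line \<Rightarrow> 'a"
  where "chart_coord e i p =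
    (THE u. \<exists>\<alpha>. \<alpha> $ i \<noteq> 0 \<and> p = proj_point \<alpha> \<and>
       u = (\<Sum>r\<in>UNIV. (\<alpha> $ deletion_map i r / \<alpha> $ i) *\<^sub>R e r))"

definition chart_matrix ::
    "('a::real_vector \<Rightarrow> 'a \<Rightarrow> 'a) \<Rightarrow> ('n::{finite,linorder} \<Rightarrow> 'a)
      \<Rightarrow> 'm::{finite,linorder} \<Rightarrow> 'm line \<Rightarrow> ((real, 'n) vec, 'n) vec"
  where "chart_matrix mul e i p = left_mult_matrix mul e (chart_coord e i p)"

definition deletion_transition ::
    "('a::real_vector \<Rightarrow> 'a \<Rightarrow> 'a) \<Rightarrow> ('n::{finite,linorder} \<Rightarrow> 'a)
      \<Rightarrow> 'm::{finite,linorder} \<Rightarrow> 'm \<Rightarrow> 'm line \<Rightarrow> ((real, 'n) vec, 'n) vec"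
  where "deletion_transition mul e i j p =
    (if i = j then mat 1 else chart_matrix mul e i p ** matrix_inv (chart_matrix mul e j p))"

abbreviation deletion_point ::
    "('a::real_vector \<Rightarrow> 'a \<Rightarrow> 'a) \<Rightarrow> ('n::{finite,linorder} \<Rightarrow> 'a)
      \<Rightarrow> 'm::{finite,linorder} \<Rightarrow> 'm line \<Rightarrow> (real, 'n) vec \<Rightarrow> ('m \<times> 'm line \<times> (real, 'n) vec) set"
  where "deletion_point mul e \<equiv> glue_class affine_chart (deletion_transition mul e)"

definition deletion_bundle ::
    "('a::real_vector \<Rightarrow> 'a \<Rightarrow> 'a) \<Rightarrow> ('n::{finite,linorder} \<Rightarrow> 'a)
      \<Rightarrow> (('m::{finite,linorder} \<times> 'm line \<times> (real, 'n) vec) set, 'm line) vbundle"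
  where "deletion_bundle mul e =
    glued_bundle real_projective_space affine_chart (deletion_transition mul e)"

end

theory Submission
  imports Defs
begin

text \<open>
  The transition functions are already written as a coboundary \<open>M\<^sub>i M\<^sub>j\<inverse>\<close>. Wherever all the
  \<open>M\<^sub>i\<close> in play are invertible, the rule \<open>w\<^sub>i = M\<^sub>i M\<^sub>j\<inverse> w\<^sub>j\<close> says exactly that \<open>M\<^sub>i\<inverse> w\<^sub>i = M\<^sub>j\<inverse> w\<^sub>j\<close>, so
  the vector \<open>M\<^sub>i\<inverse> w\<^sub>i\<close> does not depend on the chart and determines the point of the fibre: it is a
  global fibre coordinate. Only at \<open>P\<^sub>i\<close> does \<open>M\<^sub>i\<close> degenerate, which is why those points are removed.

  The topological content is separated from the algebra. The lemma \<open>glued_bundle_trivialization\<close>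
  treats an arbitrary glued bundle whose transition functions are a continuous coboundary
  \<open>h i p ** matrix_inv (h j p)\<close> over an open set \<open>X\<close>. On the disjoint union of the pieces
  \<open>(U i \<inter> X) \<times> \<real>\<^sup>n\<close> there are two maps, the gluing projection and
  \<open>(i, p, w) \<mapsto> (p, h\<^sub>i(p)\<inverse> w)\<close>. Both are quotient maps (the first because \<open>X\<close> is open, the second
  because it is continuous, open and onto) and both identify the same points; hence their targets,
  the restricted bundle and \<open>X \<times> \<real>\<^sup>n\<close>, are homeomorphic.

  What remains is to check the hypotheses for \<open>h i = chart_matrix mul e i\<close>. Invertibility:
  the chart coordinate of \<open>p\<close> vanishes only at \<open>P\<^sub>i\<close>, because \<open>\<sigma>\<^sub>i\<close> reaches every index other than \<open>i\<close>
  (\<open>chart_coord_nonzero\<close>), and left multiplication by a nonzero element of a division algebra is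
  injective (\<open>invertible_left_mult_matrix\<close>). Continuity: pulled back to homogeneous coordinates, the
  chart matrix is a combination of the fixed matrices \<open>M(e\<^sub>r)\<close> with coefficients
  \<open>\<alpha>\<^bsub>\<sigma>\<^sub>i(r)\<^esub> / \<alpha>\<^sub>i\<close> (\<open>continuous_map_chart_matrix\<close>). Openness of the charts and of \<open>X\<close>: their
  cones in \<open>\<real>\<^bsup>d+1\<^esup> - {0}\<close> are given by inequations between coordinates and \<open>0\<close>.
\<close>

section \<open>Continuity of the inverse matrix\<close>

lemma matrix_inv_invertible:
  fixes A :: "real^'n^'n"
  assumes "invertible A"
  shows "A ** matrix_inv A = mat 1" and "matrix_inv A ** A = mat 1"
proof -
  have "\<exists>A'. A ** A' = mat 1 \<and> A' ** A = mat 1"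
    using assms by (simp add: invertible_def)
  then have "A ** matrix_inv A = mat 1 \<and> matrix_inv A ** A = mat 1"
    unfolding matrix_inv_def by (rule someI_ex)
  then show "A ** matrix_inv A = mat 1" and "matrix_inv A ** A = mat 1"
    by auto
qed

lemma matrix_inv_apply:
  fixes A :: "real^'n^'n"
  assumes "invertible A"
  shows "A *v (matrix_inv A *v w) = w" and "matrix_inv A *v (A *v w) = w"
  using matrix_inv_invertible[OF assms] by (simp_all add: matrix_vector_mul_assoc)

lemma continuous_on_det:
  fixes A :: "'b::topological_space \<Rightarrow> real^'n^'n"
  assumes "continuous_on S A"
  shows "continuous_on S (\<lambda>x. det (A x))"
  unfolding det_def by (intro continuous_intros assms)

lemma continuous_on_matrix_vector_mult:
  fixes A :: "'b::topological_space \<Rightarrow> real^'n^'m"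
  assumes "continuous_on S A" and "continuous_on S w"
  shows "continuous_on S (\<lambda>x. A x *v w x)"
  unfolding matrix_vector_mult_def by (intro continuous_intros assms)

text \<open>Cramer's rule expresses the solution \<open>A\<inverse> w\<close> as a quotient of determinants, which are polynomials in
  the entries of \<open>A\<close> and \<open>w\<close>; the denominator \<open>det A\<close> does not vanish on the domain.\<close>

lemma continuous_on_matrix_inv_vector_mult:
  "continuous_on {z :: (real^'n^'n) \<times> (real^'n). invertible (fst z)}
     (\<lambda>z. matrix_inv (fst z) *v snd z)"
proof -
  let ?S = "{z :: (real^'n^'n) \<times> (real^'n). invertible (fst z)}"
  \<comment> \<open>the matrix with its \<open>k\<close>-th column replaced by the right-hand side\<close>
  let ?B = "\<lambda>(z :: (real^'n^'n) \<times> (real^'n)) k. (\<chi> i j. if j = k then snd z $ i else fst z $ i $ j) :: real^'n^'n"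
  have B: "continuous_on ?S (\<lambda>z. ?B z k)" for k
  proof (intro continuous_on_vec_lambda)
    show "continuous_on ?S (\<lambda>z. if j = k then snd z $ i else fst z $ i $ j)" for i j
      by (cases "j = k") (auto intro!: continuous_intros)
  qed
  have "continuous_on ?S (\<lambda>z. \<chi> k. det (?B z k) / det (fst z))"
    by (intro continuous_intros continuous_on_det B) (simp add: invertible_det_nz)
  moreover have "matrix_inv (fst z) *v snd z = (\<chi> k. det (?B z k) / det (fst z))" if "z \<in> ?S" for z
    using that cramer[of "fst z" "matrix_inv (fst z) *v snd z" "snd z"]
    by (simp add: invertible_det_nz matrix_inv_apply)
  ultimately show ?thesis
    by (subst continuous_on_cong[OF refl]) auto
qed

lemma continuous_map_matrix_vector_mult:
  fixes A :: "'b \<Rightarrow> real^'n^'m"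
  assumes "continuous_map T euclidean A" and "continuous_map T euclidean w"
  shows "continuous_map T euclidean (\<lambda>x. A x *v w x)"
proof -
  have "continuous_map T euclidean (\<lambda>x. (A x, w x))"
    using assms continuous_map_pairedI[of T euclidean A euclidean w] by simp
  moreover have "continuous_map euclidean euclidean (\<lambda>z :: (real^'n^'m) \<times> (real^'n). fst z *v snd z)"
    by (auto intro!: continuous_on_matrix_vector_mult continuous_intros)
  ultimately have "continuous_map T euclidean ((\<lambda>z. fst z *v snd z) \<circ> (\<lambda>x. (A x, w x)))"
    by (rule continuous_map_compose)
  then show ?thesis
    by (simp add: o_def)
qed

lemma continuous_map_matrix_inv_vector_mult:
  fixes A :: "'b \<Rightarrow> real^'n^'n"
  assumes "continuous_map T euclidean A" and "continuous_map T euclidean w"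
    and "\<And>x. x \<in> topspace T \<Longrightarrow> invertible (A x)"
  shows "continuous_map T euclidean (\<lambda>x. matrix_inv (A x) *v w x)"
proof -
  have "continuous_map T euclidean (\<lambda>x. (A x, w x))"
    using assms continuous_map_pairedI[of T euclidean A euclidean w] by simp
  then have "continuous_map T (top_of_set {z. invertible (fst z)}) (\<lambda>x. (A x, w x))"
    using assms(3) by (auto simp: continuous_map_in_subtopology)
  moreover have "continuous_map (top_of_set {z. invertible (fst z)}) euclidean
      (\<lambda>z :: (real^'n^'n) \<times> (real^'n). matrix_inv (fst z) *v snd z)"
    by (simp add: continuous_on_matrix_inv_vector_mult)
  ultimately have "continuous_map T euclidean ((\<lambda>z. matrix_inv (fst z) *v snd z) \<circ> (\<lambda>x. (A x, w x)))"
    by (rule continuous_map_compose)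
  then show ?thesis
    by (simp add: o_def)
qed


section \<open>Trivializing a glued bundle over an open set\<close>

text \<open>Since \<open>g i i p\<close> is the identity, every class contains the triple that names it, and gluing never
  moves the base point.\<close>

lemma glue_class_base_eq:
  assumes "\<And>i p. p \<in> U i \<Longrightarrow> g i i p = mat 1" and "p \<in> U i"
    and "glue_class U g i p w = glue_class U g j q v"
  shows "p = q"
proof -
  have "(i, p, w) \<in> glue_class U g i p w"
    using assms(1,2) by (simp add: glue_class_def glue_rel_def)
  then show ?thesis
    unfolding assms(3) by (simp add: glue_class_def glue_rel_def)
qed

lemma bundle_proj_glue_class:
  assumes "\<And>i p. p \<in> U i \<Longrightarrow> g i i p = mat 1" and "p \<in> U i"
  shows "bundle_proj (glued_bundle B U g) (glue_class U g i p w) = p"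
  unfolding glued_bundle_def vbundle.simps
proof (rule the_equality)
  show "\<exists>j v. p \<in> U j \<and> glue_class U g i p w = glue_class U g j p v"
    using assms(2) by blast
  show "\<exists>j v. q \<in> U j \<and> glue_class U g i p w = glue_class U g j q v \<Longrightarrow> q = p" for q
    using glue_class_base_eq[of U g, OF assms] by blast
qed

text \<open>The coboundary condition says that \<open>matrix_inv (h i p) *v w\<close> is the same for all representatives of a
  point over \<open>X\<close>, and the condition \<open>g i i p = mat 1\<close>, imposed also off \<open>X\<close>, keeps the base point of a
  class well defined, so that the part over \<open>X\<close> is an open saturated subset of the glued space.\<close>

lemma glued_bundle_trivialization:
  fixes B :: "'p topology" and U :: "'i \<Rightarrow> 'p set"
    and g :: "'i \<Rightarrow> 'i \<Rightarrow> 'p \<Rightarrow> real^'n^'n" and h :: "'i \<Rightarrow> 'p \<Rightarrow> real^'n^'n"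
  assumes U: "\<And>i. openin B (U i)"
    and X: "openin B X" and cover: "X \<subseteq> (\<Union>i. U i)"
    and diag: "\<And>i p. p \<in> U i \<Longrightarrow> g i i p = mat 1"
    and inv: "\<And>i p. p \<in> U i \<inter> X \<Longrightarrow> invertible (h i p)"
    and g: "\<And>i j p. p \<in> U i \<inter> U j \<inter> X \<Longrightarrow> g i j p = h i p ** matrix_inv (h j p)"
    and cont: "\<And>i. continuous_map (subtopology B (U i \<inter> X)) euclidean (h i)"
  obtains \<tau> where "trivialization (bundle_restrict (glued_bundle B U g) X) \<tau>"
    and "\<And>i p w. p \<in> U i \<inter> X \<Longrightarrow> \<tau> (glue_class U g i p w) = (p, matrix_inv (h i p) *v w)"
proof -
  let ?E = "glued_bundle B U g"
  let ?c = "glue_class U g"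
  \<comment> \<open>\<open>Q\<close> glues; \<open>f\<close> is the trivialization read in charts. The sets \<open>SX\<close> and \<open>EoX\<close> are the parts over \<open>X\<close>.\<close>
  define S where "S = sum_topology (\<lambda>i. prod_topology (subtopology B (U i)) (euclidean :: (real^'n) topology)) UNIV"
  define Q where "Q = (\<lambda>(i, p, w). ?c i p w)"
  define f where "f = (\<lambda>(i, p, w). (p, matrix_inv (h i p) *v w))"
  define SX where "SX = {(i, p, w :: real^'n). p \<in> U i \<inter> X}"
  define EoX where "EoX = {x \<in> topspace (total_space ?E). bundle_proj ?E x \<in> X}"
  let ?P = "prod_topology (subtopology B X) (euclidean :: (real^'n) topology)"
  have UB: "U i \<subseteq> topspace B" for i
    using U openin_subset by blast
  have XB: "X \<subseteq> topspace B"
    using X openin_subset by blast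
  have topS: "topspace S = {(i, p, w). p \<in> U i}"
    using UB by (fastforce simp: S_def)
  have E: "total_space ?E = quotient_topology S Q"
    by (simp add: glued_bundle_def S_def Q_def)
  have quot: "quotient_map S (total_space ?E) Q"
    unfolding E by (rule quotient_map_quotient_topology)
  have topE: "topspace (total_space ?E) = Q ` topspace S"
    by (simp add: E topspace_quotient_topology)
  have projQ: "bundle_proj ?E (?c i p w) = p" if "p \<in> U i" for i p w
    by (rule bundle_proj_glue_class[where U = U and g = g, OF diag that])
  have SX_eq: "{z \<in> topspace S. Q z \<in> EoX} = SX"
    unfolding EoX_def topE by (auto simp: SX_def topS Q_def projQ)
  have SXi: "{z. (i, z) \<in> SX} = (U i \<inter> X) \<times> UNIV" for i
    by (auto simp: SX_def)
  \<comment> \<open>Restricting a quotient map to a saturated set gives a quotient map when that set is open.\<close>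
  have "openin S SX"
    unfolding S_def openin_sum_topology SXi
    using U X XB by (auto simp: SX_def openin_prod_Times_iff openin_subtopology_Int2)
  moreover have "EoX \<subseteq> topspace (total_space ?E)"
    by (auto simp: EoX_def)
  then have "openin S {z \<in> topspace S. Q z \<in> EoX} \<longleftrightarrow> openin (total_space ?E) EoX"
    using quot unfolding quotient_map_def by blast
  ultimately have EoX_open: "openin (total_space ?E) EoX"
    by (simp only: SX_eq)
  have quotX: "quotient_map (subtopology S SX) (subtopology (total_space ?E) EoX) Q"
    using quotient_map_restriction[OF quot SX_eq] EoX_open by blast
  have topSX: "topspace (subtopology S SX) = SX"
    by (auto simp: topS SX_def)
  \<comment> \<open>Over \<open>X\<close> a class is a level set of \<open>f\<close>: this is the coboundary condition.\<close>
  have class_eq: "?c i p w = {(j, q, v). q = p \<and> p \<in> U j \<and> matrix_inv (h j p) *v v = matrix_inv (h i p) *v w}"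
    if p: "p \<in> U i \<inter> X" for i p w
  proof -
    have "w = g i j p *v v \<longleftrightarrow> matrix_inv (h j p) *v v = matrix_inv (h i p) *v w" if j: "p \<in> U j" for j v
    proof -
      have "g i j p *v v = h i p *v (matrix_inv (h j p) *v v)"
        using g[of p i j] p j by (simp add: matrix_vector_mul_assoc)
      then show ?thesis
        using matrix_inv_apply[OF inv[OF p]] by metis
    qed
    then show ?thesis
      using p by (auto simp: glue_class_def glue_rel_def)
  qed
  have fQ: "Q x = Q y \<longleftrightarrow> f x = f y" if xy: "x \<in> SX" "y \<in> SX" for x y
  proof -
    obtain i p w j q v where x: "x = (i, p, w)" and y: "y = (j, q, v)"
      by (metis prod_cases3)
    have p: "p \<in> U i \<inter> X" and q: "q \<in> U j \<inter> X"
      using xy by (auto simp: x y SX_def)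
    show ?thesis
    proof
      assume eq: "Q x = Q y"
      then have "p = q"
        using glue_class_base_eq[of U g p i w j q v] diag p by (simp add: Q_def x y)
      moreover have "(i, p, w) \<in> Q y"
        unfolding eq[symmetric] using p by (simp add: Q_def x class_eq)
      ultimately show "f x = f y"
        using q by (simp add: Q_def f_def x y class_eq)
    next
      assume "f x = f y"
      then have pq: "p = q" and eq: "matrix_inv (h i p) *v w = matrix_inv (h j p) *v v"
        by (auto simp: f_def x y)
      show "Q x = Q y"
        using p q eq by (simp add: Q_def x y pq class_eq)
    qed
  qed
  have cont_h: "continuous_map (prod_topology (subtopology B (U i \<inter> X)) euclidean) euclidean (\<lambda>z :: 'p \<times> (real^'n). h i (fst z))" for i
    using continuous_map_compose[OF continuous_map_fst cont] by (simp add: o_def)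
  have restrict_prod: "subtopology (prod_topology (subtopology B (U i)) euclidean) ((U i \<inter> X) \<times> UNIV)
      = prod_topology (subtopology B (U i \<inter> X)) (euclidean :: (real^'n) topology)" for i
    by (simp add: subtopology_Times subtopology_subtopology)
  have "SX = Sigma UNIV (\<lambda>i. (U i \<inter> X) \<times> UNIV)"
    by (auto simp: SX_def)
  then have SX_sum: "subtopology S SX
      = sum_topology (\<lambda>i. prod_topology (subtopology B (U i \<inter> X)) (euclidean :: (real^'n) topology)) UNIV"
    by (simp add: S_def subtopology_sum_topology restrict_prod)
  have f_cont: "continuous_map (subtopology S SX) ?P f"
  proof -
    have c: "continuous_map (prod_topology (subtopology B (U i \<inter> X)) euclidean) ?P (\<lambda>z. f (i, z))" for i
    proof -
      have "continuous_map (prod_topology (subtopology B (U i \<inter> X)) (euclidean :: (real^'n) topology)) (subtopology B X) fst"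
        by (rule continuous_map_into_subtopology[OF continuous_map_into_fulltopology[OF continuous_map_fst]])
          (use XB in auto)
      then show ?thesis
        unfolding f_def case_prod_unfold
        by (auto intro!: continuous_map_pairedI continuous_map_matrix_inv_vector_mult cont_h
            continuous_map_snd inv)
    qed
    show ?thesis
      unfolding SX_sum continuous_map_def openin_sum_topology
    proof (intro conjI allI impI ballI)
      fix V i
      assume "openin ?P V"
      then have "openin (prod_topology (subtopology B (U i \<inter> X)) euclidean)
          {z \<in> topspace (prod_topology (subtopology B (U i \<inter> X)) euclidean). f (i, z) \<in> V}"
        using c[of i] unfolding continuous_map_def by blast
      then show "openin (prod_topology (subtopology B (U i \<inter> X)) euclidean)
          {z. (i, z) \<in> {y \<in> topspace (sum_topology (\<lambda>i. prod_topology (subtopology B (U i \<inter> X)) euclidean) UNIV). f y \<in> V}}"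
        by simp
    qed (use XB in \<open>auto simp: f_def\<close>)
  qed
  have f_open: "open_map (subtopology S SX) ?P f"
    unfolding open_map_def
  proof (intro allI impI)
    fix W
    assume W: "openin (subtopology S SX) W"
    define Wi where "Wi i = {z. (i, z) \<in> W}" for i
    have Wi: "openin (prod_topology (subtopology B (U i \<inter> X)) euclidean) (Wi i)" for i
      using W unfolding SX_sum openin_sum_topology by (simp add: Wi_def)
    have WSX: "W \<subseteq> SX"
      using openin_subset[OF W] topSX by simp
    \<comment> \<open>\<open>k i\<close> inverts \<open>f\<close> on the \<open>i\<close>-th piece, so images under \<open>f\<close> are preimages under the maps \<open>k i\<close>.\<close>
    define k where "k i = (\<lambda>(p, v :: real^'n). (p, h i p *v v))" for i
    have "openin ?P {z \<in> (U i \<inter> X) \<times> UNIV. k i z \<in> Wi i}" for i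
    proof -
      let ?T = "prod_topology (subtopology B (U i \<inter> X)) (euclidean :: (real^'n) topology)"
      have k: "continuous_map ?T ?T (k i)"
        unfolding k_def case_prod_unfold
        by (intro continuous_map_pairedI continuous_map_matrix_vector_mult cont_h
            continuous_map_snd continuous_map_fst)
      have top: "topspace ?T = (U i \<inter> X) \<times> UNIV"
        using XB by auto
      have "openin ?T {z \<in> (U i \<inter> X) \<times> UNIV. k i z \<in> Wi i}"
        using openin_continuous_map_preimage[OF k Wi[of i]] unfolding top .
      also have "?T = subtopology ?P ((U i \<inter> X) \<times> UNIV)"
        by (simp add: subtopology_Times subtopology_subtopology Int_absorb1)
      finally show ?thesis
        by (rule openin_trans_full)
          (use openin_subtopology_Int[OF U[of i], of X] in \<open>simp add: openin_prod_Times_iff\<close>)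
    qed
    then have "openin ?P (\<Union>i. {z \<in> (U i \<inter> X) \<times> UNIV. k i z \<in> Wi i})"
      by (intro openin_Union) auto
    moreover have "f ` W = (\<Union>i. {z \<in> (U i \<inter> X) \<times> UNIV. k i z \<in> Wi i})"
    proof (intro subset_antisym subsetI)
      fix y
      assume "y \<in> f ` W"
      then obtain i p w where w: "(i, p, w) \<in> W" and y: "y = (p, matrix_inv (h i p) *v w)"
        by (auto simp: f_def)
      moreover have "p \<in> U i \<inter> X"
        using w WSX by (auto simp: SX_def)
      ultimately show "y \<in> (\<Union>i. {z \<in> (U i \<inter> X) \<times> UNIV. k i z \<in> Wi i})"
        by (auto simp: k_def Wi_def matrix_inv_apply inv)
    next
      fix y
      assume "y \<in> (\<Union>i. {z \<in> (U i \<inter> X) \<times> UNIV. k i z \<in> Wi i})"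
      then obtain i p v where y: "y = (p, v)" and p: "p \<in> U i \<inter> X" and w: "(i, p, h i p *v v) \<in> W"
        by (auto simp: k_def Wi_def)
      have "y = f (i, p, h i p *v v)"
        using p by (simp add: f_def y matrix_inv_apply inv)
      then show "y \<in> f ` W"
        using w by blast
    qed
    ultimately show "openin ?P (f ` W)"
      by simp
  qed
  have f_surj: "f ` SX = topspace ?P"
  proof (intro subset_antisym subsetI)
    fix y
    assume "y \<in> topspace ?P"
    then obtain p v where y: "y = (p, v)" and "p \<in> X"
      by auto
    then obtain i where p: "p \<in> U i \<inter> X"
      using cover by auto
    then have "y = f (i, p, h i p *v v)"
      by (simp add: f_def y matrix_inv_apply inv)
    then show "y \<in> f ` SX"
      using p by (auto simp: SX_def)
  qed (use XB in \<open>auto simp: f_def SX_def\<close>)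
  have f_quot: "quotient_map (subtopology S SX) ?P f"
    by (rule continuous_open_imp_quotient_map[OF f_cont f_open]) (simp only: topSX f_surj)
  obtain \<tau> where \<tau>_cont: "continuous_map (subtopology (total_space ?E) EoX) ?P \<tau>"
    and \<tau>Q: "\<And>z. z \<in> SX \<Longrightarrow> \<tau> (Q z) = f z"
  proof (rule quotient_map_lift_exists[OF quotX f_cont])
    show "f x = f y" if "x \<in> topspace (subtopology S SX)" "y \<in> topspace (subtopology S SX)" "Q x = Q y" for x y
      using that fQ unfolding topSX by blast
  qed (use topSX in blast)
  have \<tau>: "\<tau> (?c i p w) = (p, matrix_inv (h i p) *v w)" if "p \<in> U i \<inter> X" for i p w
    using \<tau>Q[of "(i, p, w)"] that by (simp add: SX_def Q_def f_def)
  have topEoX: "topspace (subtopology (total_space ?E) EoX) = Q ` SX"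
    using quotX topSX unfolding quotient_map_def by metis
  have \<tau>_quot: "quotient_map (subtopology (total_space ?E) EoX) ?P \<tau>"
  proof (rule quotient_map_from_composition)
    show "continuous_map (subtopology S SX) (subtopology (total_space ?E) EoX) Q"
      using quotX by (rule quotient_imp_continuous_map)
    show "quotient_map (subtopology S SX) ?P (\<tau> \<circ> Q)"
      using f_quot by (rule quotient_map_eq) (simp add: topSX \<tau>Q del: topspace_subtopology)
  qed (rule \<tau>_cont)
  have "inj_on \<tau> (Q ` SX)"
  proof (rule inj_onI, elim imageE)
    fix x y a b
    assume "\<tau> x = \<tau> y" and x: "x = Q a" "a \<in> SX" and y: "y = Q b" "b \<in> SX"
    then have "f a = f b"
      using \<tau>Q by metis
    then show "x = y"
      using fQ x y by blast
  qed
  then have homeo: "homeomorphic_map (subtopology (total_space ?E) EoX) ?P \<tau>"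
    unfolding homeomorphic_map_def topEoX using \<tau>_quot by blast
  have sub_EoX: "subtopology (total_space ?E) {x. bundle_proj ?E x \<in> X} = subtopology (total_space ?E) EoX"
  proof -
    have "EoX = topspace (total_space ?E) \<inter> {x. bundle_proj ?E x \<in> X}"
      by (auto simp: EoX_def)
    then show ?thesis
      by (simp only: subtopology_restrict)
  qed
  \<comment> \<open>Fibre operations computed in two charts have the same image under \<open>\<tau>\<close>, by linearity of the
    inverse matrices, and hence the same class.\<close>
  have add: "fibre_add ?E (?c i p v) (?c i p w) = ?c i p (v + w)" if p: "p \<in> U i \<inter> X" for i p v w
    unfolding glued_bundle_def vbundle.simps
  proof (rule the_equality)
    fix z
    assume "\<exists>j q v' w'. q \<in> U j \<and> ?c i p v = ?c j q v' \<and> ?c i p w = ?c j q w' \<and> z = ?c j q (v' + w')"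
    then obtain j q v' w' where q: "q \<in> U j" and v': "?c i p v = ?c j q v'" and w': "?c i p w = ?c j q w'"
      and z: "z = ?c j q (v' + w')"
      by blast
    have "p = q"
      using glue_class_base_eq[of U g p i v j q v'] diag p v' by simp
    with q p have q: "p \<in> U j \<inter> X" "q = p" by auto
    have "matrix_inv (h i p) *v (v + w) = matrix_inv (h j p) *v (v' + w')"
      using arg_cong[OF v', of \<tau>] arg_cong[OF w', of \<tau>] p q by (simp add: \<tau> matrix_vector_right_distrib)
    then show "z = ?c i p (v + w)"
      using p q by (simp add: z class_eq)
  qed (use p in blast)
  have scale: "fibre_scale ?E a (?c i p w) = ?c i p (a *\<^sub>R w)" if p: "p \<in> U i \<inter> X" for a i p w
    unfolding glued_bundle_def vbundle.simps
  proof (rule the_equality)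
    fix z
    assume "\<exists>j q w'. q \<in> U j \<and> ?c i p w = ?c j q w' \<and> z = ?c j q (a *\<^sub>R w')"
    then obtain j q w' where q: "q \<in> U j" and w': "?c i p w = ?c j q w'" and z: "z = ?c j q (a *\<^sub>R w')"
      by blast
    have "p = q"
      using glue_class_base_eq[of U g p i w j q w'] diag p w' by simp
    with q p have q: "p \<in> U j \<inter> X" "q = p" by auto
    have "matrix_inv (h i p) *v (a *\<^sub>R w) = matrix_inv (h j p) *v (a *\<^sub>R w')"
      using arg_cong[OF w', of \<tau>] p q by (simp add: \<tau> matrix_vector_mult_scaleR)
    then show "z = ?c i p (a *\<^sub>R w)"
      using p q by (simp add: z class_eq)
  qed (use p in blast)
  have rep: "\<exists>i p w. p \<in> U i \<inter> X \<and> x = ?c i p w" if "x \<in> Q ` SX" for x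
    using that by (auto simp: Q_def SX_def)
  have "trivialization (bundle_restrict ?E X) \<tau>"
    unfolding bundle_iso_def
  proof (intro conjI ballI allI impI)
    show "homeomorphic_map (total_space (bundle_restrict ?E X))
        (total_space (product_bundle (base_space (bundle_restrict ?E X)))) \<tau>"
      using homeo sub_EoX by (simp add: bundle_restrict_def product_bundle_def) (simp add: glued_bundle_def)
  next
    fix x
    assume "x \<in> topspace (total_space (bundle_restrict ?E X))"
    then have "x \<in> Q ` SX"
      by (simp add: bundle_restrict_def sub_EoX topEoX del: topspace_subtopology)
    then obtain i p w where p: "p \<in> U i \<inter> X" and x: "x = ?c i p w"
      using rep by blast
    show "bundle_proj (product_bundle (base_space (bundle_restrict ?E X))) (\<tau> x) = bundle_proj (bundle_restrict ?E X) x"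
      using p by (simp add: x \<tau> projQ bundle_restrict_def product_bundle_def)
    show "\<tau> (fibre_scale (bundle_restrict ?E X) a x)
        = fibre_scale (product_bundle (base_space (bundle_restrict ?E X))) a (\<tau> x)" for a
      using p by (simp add: x \<tau> scale bundle_restrict_def product_bundle_def matrix_vector_mult_scaleR)
    fix y
    assume "y \<in> topspace (total_space (bundle_restrict ?E X))"
    then have "y \<in> Q ` SX"
      by (simp add: bundle_restrict_def sub_EoX topEoX del: topspace_subtopology)
    then obtain j q v where q: "q \<in> U j \<inter> X" and y: "y = ?c j q v"
      using rep by blast
    assume "bundle_proj (bundle_restrict ?E X) x = bundle_proj (bundle_restrict ?E X) y"
    then have "q = p"
      using p q by (simp add: x y projQ bundle_restrict_def)
    \<comment> \<open>The fibre sum is computed in one chart, so \<open>y\<close> is moved to the chart of \<open>x\<close>.\<close>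
    then have y': "y = ?c i p (h i p *v (matrix_inv (h j p) *v v))"
      using p q by (simp add: y class_eq matrix_inv_apply inv)
    show "\<tau> (fibre_add (bundle_restrict ?E X) x y)
        = fibre_add (product_bundle (base_space (bundle_restrict ?E X))) (\<tau> x) (\<tau> y)"
      using p by (simp add: x y' \<tau> add bundle_restrict_def product_bundle_def matrix_vector_right_distrib)
  qed (simp add: product_bundle_def)
  then show ?thesis
    using that \<tau> by blast
qed

section \<open>Matrices of left multiplications\<close>

lemma orthonormal_basis_coefficients:
  assumes "bilinear (polar_form N)" and "orthonormal_basis N e"
  shows "polar_form N (\<Sum>r\<in>UNIV. c r *\<^sub>R e r) (e (s :: 'n::finite)) = c s"
proof -
  have l: "linear (\<lambda>u. polar_form N u (e s))"
    using assms(1) by (simp add: bilinear_def)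
  have "polar_form N (\<Sum>r\<in>UNIV. c r *\<^sub>R e r) (e s) = (\<Sum>r\<in>UNIV. c r * polar_form N (e r) (e s))"
    by (simp add: linear_sum[OF l] linear_cmul[OF l])
  also have "\<dots> = (\<Sum>r\<in>UNIV. if r = s then c r else 0)"
    using assms(2) unfolding orthonormal_basis_def by (intro sum.cong) auto
  also have "\<dots> = c s"
    by simp
  finally show ?thesis .
qed

lemma
  fixes e :: "'n::finite \<Rightarrow> 'a::real_vector"
  assumes "bilinear (polar_form N)" and "orthonormal_basis N e"
  shows orthonormal_basis_inj: "inj e"
    and orthonormal_basis_independent: "independent (range e)"
proof -
  show inj: "inj e"
  proof (rule injI)
    fix r s
    assume "e r = e s"
    then show "r = s"
      using assms(2) unfolding orthonormal_basis_def by (metis zero_neq_one)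
  qed
  have "c b = 0" if sum: "(\<Sum>x\<in>range e. c x *\<^sub>R x) = 0" and b: "b \<in> range e" for c b
  proof -
    obtain s where s: "b = e s"
      using b by auto
    have "(\<Sum>r\<in>UNIV. c (e r) *\<^sub>R e r) = 0"
      using sum by (simp add: sum.reindex[OF inj])
    moreover have "linear (\<lambda>u. polar_form N u (e s))"
      using assms(1) by (simp add: bilinear_def)
    ultimately show ?thesis
      using orthonormal_basis_coefficients[OF assms, of "\<lambda>r. c (e r)" s] linear_0 s by fastforce
  qed
  then show "independent (range e)"
    by (intro independent_if_scalars_zero) auto
qed

lemma left_mult_matrix_sum:
  assumes "bilinear mul" and "independent (range e)" and "span (range e) = UNIV"
  shows "left_mult_matrix mul e (\<Sum>r\<in>I. c r *\<^sub>R u r) = (\<Sum>r\<in>I. c r *\<^sub>R left_mult_matrix mul e (u r))"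
proof -
  have l: "linear (\<lambda>u. mul u v)" for v
    using assms(1) by (simp add: bilinear_def)
  show ?thesis
    by (simp add: left_mult_matrix_def vec_eq_iff linear_sum[OF l] linear_cmul[OF l]
      representation_sum representation_scale assms)
qed

text \<open>The matrix sends the coordinate vector of \<open>v\<close> to that of \<open>mul u v\<close>, so a kernel vector is the
  coordinate vector of some \<open>v\<close> with \<open>mul u v = 0\<close>. A square matrix with trivial kernel is invertible.\<close>

lemma invertible_left_mult_matrix:
  fixes e :: "'n::finite \<Rightarrow> 'a::real_vector"
  assumes "bilinear mul" and "inj (mul u)"
    and "inj e" and "independent (range e)" and "span (range e) = UNIV"
  shows "invertible (left_mult_matrix mul e u)"
proof -
  have l: "linear (mul u)"
    using assms(1) by (simp add: bilinear_def)
  have "x = 0" if ker: "left_mult_matrix mul e u *v x = 0" for x :: "real^'n"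
  proof -
    let ?v = "\<Sum>c\<in>UNIV. x $ c *\<^sub>R e c"
    have "representation (range e) (mul u ?v) (e r) = (left_mult_matrix mul e u *v x) $ r" for r
      by (simp add: left_mult_matrix_def matrix_vector_mult_def linear_sum[OF l] linear_cmul[OF l]
        representation_sum representation_scale assms mult.commute)
    then have "representation (range e) (mul u ?v) b = 0" if "b \<in> range e" for b
      using that ker by auto
    then have "mul u ?v = 0"
      using sum_representation_eq[of "range e" "mul u ?v" "range e"] assms by simp
    then have "mul u ?v = mul u 0"
      using linear_0[OF l] by simp
    then have "?v = 0"
      by (rule injD[OF assms(2)])
    then have "(\<Sum>b\<in>range e. (x $ inv e b) *\<^sub>R b) = 0"
      by (simp add: sum.reindex assms(3))
    then have "x $ inv e b = 0" if "b \<in> range e" for b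
      using assms(4) that independentD[of "range e" "range e" "\<lambda>b. x $ inv e b" b] by auto
    then have "x $ inv e (e r) = 0" for r
      by blast
    then show "x = 0"
      using assms(3) by (simp add: vec_eq_iff)
  qed
  then show ?thesis
    by (simp add: invertible_left_inverse matrix_left_invertible_ker)
qed

section \<open>Increasing bijections and the deletion of an index\<close>

text \<open>By induction on \<open>A\<close>: the largest element of \<open>A\<close> must go to the largest element of \<open>B\<close>.\<close>

lemma strict_mono_bij_exists:
  fixes A :: "'n::linorder set" and B :: "'m::linorder set"
  assumes "finite A" and "finite B" and "card A = card B"
  shows "\<exists>f. strict_mono_on A f \<and> bij_betw f A B"
  using assms
proof (induction A arbitrary: B rule: finite_linorder_max_induct)
  case empty
  then show ?case
    by (auto simp: strict_mono_on_def bij_betw_def)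
next
  case (insert a A)
  have "a \<notin> A"
    using insert.hyps(2) by blast
  then have card: "card B = Suc (card A)"
    using insert by simp
  then have "B \<noteq> {}"
    by auto
  then have max: "Max B \<in> B" "\<And>b. b \<in> B - {Max B} \<Longrightarrow> b < Max B"
    using insert.prems(1) by (auto simp: less_le)
  obtain f where mono: "strict_mono_on A f" and bij: "bij_betw f A (B - {Max B})"
    using insert.IH[of "B - {Max B}"] insert.prems(1) card max(1) by auto
  let ?f = "f(a := Max B)"
  have "f x < Max B" if "x \<in> A" for x
    using max(2) bij that by (auto simp: bij_betw_def)
  then have "strict_mono_on (insert a A) ?f"
    using mono insert.hyps(2) by (fastforce simp: strict_mono_on_def dest: less_asym)
  moreover have "bij_betw ?f A (B - {Max B})"
    using bij \<open>a \<notin> A\<close> by (subst bij_betw_cong[of A ?f f]) auto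
  then have "bij_betw ?f (A \<union> {a}) ((B - {Max B}) \<union> {Max B})"
    using notIn_Un_bij_betw[of a A ?f "B - {Max B}"] \<open>a \<notin> A\<close> by simp
  then have "bij_betw ?f (insert a A) B"
    using max(1) by (simp add: insert_absorb)
  ultimately show ?case
    by blast
qed

text \<open>At the least argument \<open>r\<close> where the two maps differ, \<open>f r = g s\<close> for some \<open>s\<close>, and \<open>s\<close> is not below
  \<open>r\<close>, as \<open>f s = g s\<close> would contradict injectivity. Hence \<open>g r \<le> f r\<close>, and symmetrically.\<close>

lemma strict_mono_range_unique:
  fixes f g :: "'n::{finite,linorder} \<Rightarrow> 'm::linorder"
  assumes "strict_mono f" and "strict_mono g" and "range f = range g"
  shows "f = g"
proof (rule ccontr)
  assume "f \<noteq> g"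
  let ?D = "{r. f r \<noteq> g r}"
  have D: "?D \<noteq> {}"
    using \<open>f \<noteq> g\<close> by auto
  define r where "r = Min ?D"
  have r: "f r \<noteq> g r"
    using Min_in[of ?D] D by (simp add: r_def)
  have below: "f s = g s" if "s < r" for s
    using Min_le[of ?D s] that by (fastforce simp: r_def)
  obtain s where s: "f r = g s"
    using assms(3) by (metis rangeE rangeI)
  obtain t where t: "g r = f t"
    using assms(3) by (metis rangeE rangeI)
  have "\<not> s < r"
    using below[of s] s assms(1) by (metis less_irrefl strict_mono_eq)
  moreover have "\<not> t < r"
    using below[of t] t assms(2) by (metis less_irrefl strict_mono_eq)
  ultimately have "g r \<le> g s" and "f r \<le> f t"
    using assms(1,2) by (simp_all add: strict_mono_less_eq)
  then show False
    using r s t by simp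
qed

text \<open>Existence and uniqueness of the increasing bijection make the definite description in
  \<open>deletion_map\<close> meaningful.\<close>

lemma deletion_map_bij:
  assumes "CARD('m::{finite,linorder}) = CARD('n::{finite,linorder}) + 1"
  shows "bij_betw (deletion_map i :: 'n \<Rightarrow> 'm) UNIV (UNIV - {i})"
proof -
  have "card (UNIV :: 'n set) = card (UNIV - {i} :: 'm set)"
    using assms by simp
  then obtain f :: "'n \<Rightarrow> 'm" where "strict_mono f \<and> bij_betw f UNIV (UNIV - {i})"
    using strict_mono_bij_exists[of "UNIV :: 'n set" "UNIV - {i} :: 'm set"] by auto
  moreover have "g = f'" if "strict_mono g \<and> bij_betw g UNIV (UNIV - {i})"
    and "strict_mono f' \<and> bij_betw f' UNIV (UNIV - {i})" for g f' :: "'n \<Rightarrow> 'm"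
    using that strict_mono_range_unique[of g f'] by (simp add: bij_betw_def)
  ultimately have "\<exists>!f :: 'n \<Rightarrow> 'm. strict_mono f \<and> bij_betw f UNIV (UNIV - {i})"
    by blast
  from theI'[OF this] show ?thesis
    unfolding deletion_map_def by blast
qed

section \<open>Charts of real projective space\<close>

lemma proj_point_eqD:
  assumes "proj_point \<alpha> = proj_point \<beta>" and "\<beta> \<noteq> 0"
  obtains c where "c \<noteq> 0" and "\<beta> = c *\<^sub>R \<alpha>"
proof -
  have "\<beta> \<in> span {\<beta>}"
    by (simp add: span_base)
  then have "\<beta> \<in> span {\<alpha>}"
    using assms(1) by (simp add: proj_point_def)
  then obtain c where "\<beta> = c *\<^sub>R \<alpha>"
    by (auto simp: span_singleton)
  moreover from this have "c \<noteq> 0"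
    using assms(2) by auto
  ultimately show thesis
    using that by blast
qed

lemma proj_point_scaleR:
  assumes "c \<noteq> 0"
  shows "proj_point (c *\<^sub>R \<alpha>) = proj_point \<alpha>"
proof -
  have "c *\<^sub>R \<alpha> \<in> span {\<alpha>}"
    by (simp add: span_base span_scale)
  moreover have "\<alpha> \<in> span {c *\<^sub>R \<alpha>}"
    using assms span_scale[of "c *\<^sub>R \<alpha>" "{c *\<^sub>R \<alpha>}" "1 / c"] by (simp add: span_base)
  ultimately show ?thesis
    unfolding proj_point_def by (intro span_eq[THEN iffD2]) auto
qed

lemma proj_point_in_affine_chart_iff: "proj_point \<alpha> \<in> affine_chart i \<longleftrightarrow> \<alpha> $ i \<noteq> 0"
proof
  assume "proj_point \<alpha> \<in> affine_chart i"
  then obtain \<beta> where \<beta>: "\<beta> $ i \<noteq> 0" and eq: "proj_point \<alpha> = proj_point \<beta>"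
    by (auto simp: affine_chart_def)
  have "\<beta> \<noteq> 0"
    using \<beta> by auto
  with eq obtain c where "\<beta> = c *\<^sub>R \<alpha>"
    by (rule proj_point_eqD)
  then show "\<alpha> $ i \<noteq> 0"
    using \<beta> by auto
qed (auto simp: affine_chart_def)

lemma proj_point_eq_coordinate_point_iff:
  assumes "\<alpha> \<noteq> 0"
  shows "proj_point \<alpha> = coordinate_point i \<longleftrightarrow> (\<forall>j. j \<noteq> i \<longrightarrow> \<alpha> $ j = 0)"
proof
  assume "proj_point \<alpha> = coordinate_point i"
  then obtain c where "\<alpha> = c *\<^sub>R axis i 1"
    using proj_point_eqD[of "axis i 1" \<alpha>] assms by (auto simp: coordinate_point_def)
  then show "\<forall>j. j \<noteq> i \<longrightarrow> \<alpha> $ j = 0"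
    by (simp add: axis_def)
next
  assume "\<forall>j. j \<noteq> i \<longrightarrow> \<alpha> $ j = 0"
  then have *: "\<alpha> = (\<alpha> $ i) *\<^sub>R axis i 1"
    by (auto simp: vec_eq_iff axis_def)
  then have "\<alpha> $ i \<noteq> 0"
    using assms by (metis scaleR_zero_left)
  then show "proj_point \<alpha> = coordinate_point i"
    using proj_point_scaleR[of "\<alpha> $ i" "axis i 1"] * by (simp add: coordinate_point_def)
qed

lemma topspace_real_projective_space: "topspace real_projective_space = proj_point ` (UNIV - {0})"
  by (simp add: real_projective_space_def topspace_quotient_topology)

lemma quotient_map_proj_point:
  "quotient_map (top_of_set (UNIV - {0})) real_projective_space proj_point"
  unfolding real_projective_space_def by (rule quotient_map_quotient_topology)

text \<open>The topology of projective space lives on the punctured space; as that space is open, openness of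
  the cone over \<open>V\<close> may be tested in \<open>\<real>\<^bsup>d+1\<^esup>\<close>.\<close>

lemma openin_real_projective_spaceI:
  assumes "V \<subseteq> topspace real_projective_space" and "open {\<alpha>. \<alpha> \<noteq> 0 \<and> proj_point \<alpha> \<in> V}"
  shows "openin real_projective_space V"
proof -
  have "openin (top_of_set (UNIV - {0})) {\<alpha> \<in> UNIV - {0}. proj_point \<alpha> \<in> V}"
    by (rule open_subset) (use assms(2) in auto)
  then show ?thesis
    using assms(1) unfolding real_projective_space_def openin_quotient_topology
    by (simp add: topspace_quotient_topology)
qed

lemma affine_chart_subset: "affine_chart i \<subseteq> topspace real_projective_space"
  by (auto simp: affine_chart_def topspace_real_projective_space intro!: imageI)

lemma openin_affine_chart: "openin real_projective_space (affine_chart i)"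
proof (rule openin_real_projective_spaceI[OF affine_chart_subset])
  have "{\<alpha>. \<alpha> \<noteq> 0 \<and> proj_point \<alpha> \<in> affine_chart i} = {\<alpha>. \<alpha> $ i \<noteq> 0}"
    by (auto simp: proj_point_in_affine_chart_iff)
  also have "open \<dots>"
    by (intro open_Collect_neq continuous_intros)
  finally show "open {\<alpha>. \<alpha> \<noteq> 0 \<and> proj_point \<alpha> \<in> affine_chart i}" .
qed

lemma affine_charts_cover:
  "topspace real_projective_space = (\<Union>i::'m::finite. affine_chart i)"
proof
  show "topspace real_projective_space \<subseteq> (\<Union>i::'m. affine_chart i)"
  proof
    fix p :: "'m line"
    assume "p \<in> topspace real_projective_space"
    then obtain \<alpha> where p: "p = proj_point \<alpha>" and "\<alpha> \<noteq> 0"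
      by (auto simp: topspace_real_projective_space)
    then obtain i where "\<alpha> $ i \<noteq> 0"
      by (auto simp: vec_eq_iff)
    then show "p \<in> (\<Union>i. affine_chart i)"
      by (auto simp: p proj_point_in_affine_chart_iff)
  qed
qed (use affine_chart_subset in blast)

lemma openin_minus_coordinate_points:
  "openin real_projective_space
     (topspace real_projective_space - range (coordinate_point :: 'm::finite \<Rightarrow> _))"
proof (rule openin_real_projective_spaceI)
  have "proj_point \<alpha> \<in> topspace real_projective_space - range coordinate_point
      \<longleftrightarrow> (\<forall>i. \<exists>j. j \<noteq> i \<and> \<alpha> $ j \<noteq> 0)" if "\<alpha> \<noteq> 0" for \<alpha> :: "real^'m"
    using that proj_point_eq_coordinate_point_iff[OF that]
    by (auto simp: topspace_real_projective_space image_iff)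
  then have "{\<alpha>. \<alpha> \<noteq> 0 \<and> proj_point \<alpha> \<in> topspace real_projective_space - range coordinate_point}
      = {\<alpha> :: real^'m. \<alpha> \<noteq> 0 \<and> (\<forall>i. \<exists>j. j \<noteq> i \<and> \<alpha> $ j \<noteq> 0)}"
    by (simp cong: conj_cong)
  also have "\<dots> = {\<alpha>. \<alpha> \<noteq> 0} \<inter> (\<Inter>i. \<Union>j\<in>- {i}. {\<alpha>. \<alpha> $ j \<noteq> 0})"
    by auto
  also have "open \<dots>"
    by (intro open_Int open_INT ballI open_UN open_Collect_neq continuous_intros) auto
  finally show "open {\<alpha>. \<alpha> \<noteq> 0 \<and> proj_point \<alpha> \<in> topspace real_projective_space - range (coordinate_point :: 'm \<Rightarrow> _)}" .
qed blast

section \<open>Chart coordinates and chart matrices\<close>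

lemma chart_coord_proj_point:
  assumes "\<alpha> $ i \<noteq> 0"
  shows "chart_coord e i (proj_point \<alpha>) = (\<Sum>r\<in>UNIV. (\<alpha> $ deletion_map i r / \<alpha> $ i) *\<^sub>R e r)"
  unfolding chart_coord_def
proof (rule the_equality)
  fix u
  assume "\<exists>\<beta>. \<beta> $ i \<noteq> 0 \<and> proj_point \<alpha> = proj_point \<beta> \<and>
      u = (\<Sum>r\<in>UNIV. (\<beta> $ deletion_map i r / \<beta> $ i) *\<^sub>R e r)"
  then obtain \<beta> where \<beta>: "\<beta> $ i \<noteq> 0" "proj_point \<alpha> = proj_point \<beta>"
    and u: "u = (\<Sum>r\<in>UNIV. (\<beta> $ deletion_map i r / \<beta> $ i) *\<^sub>R e r)"
    by blast
  have "\<beta> \<noteq> 0"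
    using \<beta>(1) by auto
  with \<beta>(2) obtain c where "c \<noteq> 0" "\<beta> = c *\<^sub>R \<alpha>"
    by (rule proj_point_eqD)
  then show "u = (\<Sum>r\<in>UNIV. (\<alpha> $ deletion_map i r / \<alpha> $ i) *\<^sub>R e r)"
    by (simp add: u)
qed (use assms in blast)

text \<open>If the chart coordinate vanishes, so do all homogeneous coordinates with index in the range of
  \<open>deletion_map i\<close>, that is, all except the \<open>i\<close>-th.\<close>

lemma chart_coord_nonzero:
  fixes e :: "'n::{finite,linorder} \<Rightarrow> 'a::real_vector" and i :: "'m::{finite,linorder}"
  assumes "CARD('m) = CARD('n) + 1" and "inj e" and "independent (range e)"
    and "p \<in> affine_chart i" and "p \<noteq> coordinate_point i"
  shows "chart_coord e i p \<noteq> 0"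
proof
  assume zero: "chart_coord e i p = 0"
  obtain \<alpha> where \<alpha>: "\<alpha> $ i \<noteq> 0" and p: "p = proj_point \<alpha>"
    using assms(4) by (auto simp: affine_chart_def)
  let ?c = "\<lambda>r. \<alpha> $ deletion_map i r / \<alpha> $ i"
  have "(\<Sum>b\<in>range e. ?c (inv e b) *\<^sub>R b) = 0"
    using zero \<alpha> by (simp add: p chart_coord_proj_point sum.reindex assms(2))
  then have "?c (inv e (e r)) = 0" for r
    using independentD[OF assms(3), of "range e" "\<lambda>b. ?c (inv e b)" "e r"] by auto
  then have "\<alpha> $ deletion_map i r = 0" for r :: 'n
    using \<alpha> by (simp add: assms(2))
  moreover have "j \<in> range (deletion_map i :: 'n \<Rightarrow> 'm)" if "j \<noteq> i" for j
    using that deletion_map_bij[OF assms(1), of i] by (simp add: bij_betw_def)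
  ultimately have "\<alpha> $ j = 0" if "j \<noteq> i" for j
    using that by blast
  moreover have "\<alpha> \<noteq> 0"
    using \<alpha> by auto
  ultimately have "p = coordinate_point i"
    using proj_point_eq_coordinate_point_iff[of \<alpha> i] by (simp add: p)
  with assms(5) show False
    by contradiction
qed

text \<open>Over the open chart \<open>proj_point\<close> is still a quotient map, so it suffices that the chart matrix is
  continuous in homogeneous coordinates, where linearity of \<open>u \<mapsto> M(u)\<close> gives an explicit formula.\<close>

lemma continuous_map_chart_matrix:
  fixes e :: "'n::{finite,linorder} \<Rightarrow> 'a::real_vector" and i :: "'m::{finite,linorder}"
  assumes "bilinear mul" and "independent (range e)" and "span (range e) = UNIV"
  shows "continuous_map (subtopology real_projective_space (affine_chart i)) euclidean (chart_matrix mul e i)"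
proof (rule continuous_compose_quotient_map)
  let ?L = "{\<alpha> :: (real, 'm) vec. \<alpha> $ i \<noteq> 0}"
  have preimage: "{\<alpha> \<in> topspace (top_of_set (UNIV - {0})). proj_point \<alpha> \<in> affine_chart i} = ?L"
    by (auto simp: proj_point_in_affine_chart_iff)
  then have "quotient_map (subtopology (top_of_set (UNIV - {0})) ?L)
      (subtopology real_projective_space (affine_chart i)) proj_point"
    using quotient_map_restriction[OF quotient_map_proj_point] openin_affine_chart by blast
  moreover have L: "(UNIV - {0}) \<inter> ?L = ?L"
    by auto
  ultimately show "quotient_map (top_of_set ?L) (subtopology real_projective_space (affine_chart i)) proj_point"
    by (simp only: subtopology_subtopology L)
  have "continuous_on ?L (\<lambda>\<alpha>. \<Sum>r\<in>UNIV. (\<alpha> $ deletion_map i r / \<alpha> $ i) *\<^sub>R left_mult_matrix mul e (e r))"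
    by (intro continuous_intros) simp
  then have "continuous_on ?L (chart_matrix mul e i \<circ> proj_point)"
  proof (rule continuous_on_eq)
    fix \<alpha>
    assume "\<alpha> \<in> ?L"
    then show "(\<Sum>r\<in>UNIV. (\<alpha> $ deletion_map i r / \<alpha> $ i) *\<^sub>R left_mult_matrix mul e (e r))
        = (chart_matrix mul e i \<circ> proj_point) \<alpha>"
      by (simp add: chart_matrix_def chart_coord_proj_point left_mult_matrix_sum assms)
  qed
  then show "continuous_map (top_of_set ?L) euclidean (chart_matrix mul e i \<circ> proj_point)"
    unfolding continuous_map_iff_continuous .
qed

section \<open>Triviality of the coordinate-deletion bundle\<close>

theorem proposition4p2:
  fixes mul :: "'a::real_vector \<Rightarrow> 'a \<Rightarrow> 'a"
    and one :: 'a
    and N :: "'a \<Rightarrow> real"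
    and e :: "'n::{finite,linorder} \<Rightarrow> 'a"
    and X :: "'m::{finite,linorder} line set"
  assumes "composition_division_algebra mul one N"
    and "dim (UNIV :: 'a set) = CARD('n)"
    and "CARD('n) \<in> {2, 4, 8}"
    and "CARD('m) = CARD('n) + 1"
    and "orthonormal_basis N e"
    and "X = topspace real_projective_space - range coordinate_point"
  shows "\<exists>\<tau> :: ('m \<times> 'm line \<times> (real, 'n) vec) set \<Rightarrow> 'm line \<times> (real, 'n) vec.
      trivialization (bundle_restrict (deletion_bundle mul e) X) \<tau> \<and>
      (\<forall>i. \<forall>p \<in> affine_chart i \<inter> X. \<forall>w.
         \<tau> (deletion_point mul e i p w) = (p, matrix_inv (chart_matrix mul e i p) *v w))"
proof -
  interpret composition_division_algebra mul one N
    by (rule assms(1))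
  have span: "span (range e) = UNIV"
    using assms(5) by (simp add: orthonormal_basis_def)
  have inj: "inj e" and indep: "independent (range e)"
    using orthonormal_basis_inj orthonormal_basis_independent polar_bilinear assms(5) by blast+
  have inv: "invertible (chart_matrix mul e i p)" if p: "p \<in> affine_chart i \<inter> X" for i p
  proof -
    have "chart_coord e i p \<noteq> 0"
      using p assms(6) by (intro chart_coord_nonzero[OF assms(4) inj indep]) auto
    then have "inj (mul (chart_coord e i p))"
      using division_left bij_is_inj by blast
    then show ?thesis
      unfolding chart_matrix_def by (rule invertible_left_mult_matrix[OF mult_bilinear _ inj indep span])
  qed
  have X_open: "openin real_projective_space X"
    unfolding assms(6) by (rule openin_minus_coordinate_points)
  have X_cover: "X \<subseteq> (\<Union>i. affine_chart i)"
    using affine_charts_cover assms(6) by blast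
  have diag: "deletion_transition mul e i i p = mat 1" for i :: 'm and p
    by (simp add: deletion_transition_def)
  have coboundary: "deletion_transition mul e i j p
      = chart_matrix mul e i p ** matrix_inv (chart_matrix mul e j p)"
    if "p \<in> affine_chart i \<inter> affine_chart j \<inter> X" for i j p
    using that matrix_inv_invertible(1)[OF inv[of p i]] by (auto simp: deletion_transition_def)
  have cont: "continuous_map (subtopology real_projective_space (affine_chart i \<inter> X)) euclidean
      (chart_matrix mul e i)" for i
    by (rule continuous_map_from_subtopology_mono[OF
          continuous_map_chart_matrix[OF mult_bilinear indep span]]) blast
  obtain \<tau> where "trivialization (bundle_restrict
        (glued_bundle real_projective_space affine_chart (deletion_transition mul e)) X) \<tau>"
    and "\<And>i p w. p \<in> affine_chart i \<inter> X
      \<Longrightarrow> \<tau> (deletion_point mul e i p w) = (p, matrix_inv (chart_matrix mul e i p) *v w)"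
    using glued_bundle_trivialization[where U = affine_chart and g = "deletion_transition mul e"
        and h = "chart_matrix mul e", OF openin_affine_chart X_open X_cover diag inv coboundary cont]
    by blast
  then show ?thesis
    unfolding deletion_bundle_def by blast
qed

end
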